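(* Let $A,B,H,K$ be any logically independent events. The set $\Pi$ of all the coherent assessments $(x,y,z,\mu)$ on the family $\mathcal{F}=\{A|H,\ B|K,\ (A|H)\wedge_{K}(B|K),\ (B|K)|_{K}(A|H)\}$ is $\Pi=\Pi'\cup\Pi''$, where $$\Pi'=\{(x,y,z,\mu): x\in(0,1],\ y\in[0,1],\ z\in[z',z''],\ \mu=\tfrac{z}{x}\},$$ with $z'=0$, $z''=\min\{x,y\}$, and $\Pi''=\{(0,y,0,\mu):(y,\mu)\in[0,1]^2\}$.
   Context: Events are two-valued entities identified with their indicators (values $1/0$); $\emptyset$ is the impossible event, $AB=A\wedge B$, $\overline{A}$ is the negation. Four events are logically independent if all $16$ conjunctions obtained by taking each event or its negation are different from $\emptyset$. For $H\neq\emptyset$ the conditional event $E|H$ is true if $EH$ is true, false if $\overline{E}H$ is true, void if $\overline{H}$ is true. Once $P(E|H)=p$ is assessed, $E|H$ is also the random quantity $EH+p\overline{H}$; numerically $\overline{A}|H=1-A|H$. Conjunction (a conditional event; the subscript $K$ is only a name, unrelated to the event $K$): $(A|H)\wedge_K(B|K)=AHBK|(HK\vee\overline{A}H\vee\overline{B}K)$. Iterated conditional: $(B|K)|_K(A|H)$ is the random quantity $(A|H)\wedge_K(B|K)+\mu\,(\overline{A}|H)$, where $\mu=\mathbb{P}[(B|K)|_K(A|H)]$ is its assessed prevision (the amount paid to receive it), the right-hand side being computed numerically from $x=P(A|H)$, $z=P[(A|H)\wedge_K(B|K)]$ and $\mu$. Also $y=P(B|K)$. Coherence: an assessment of real values $m_j$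 on a finite family of such objects $X_j$ (conditional events, as random quantities, and iterated conditionals) is coherent iff for every nonempty subfamily $J$ and all reals $s_j$, the random gain $\sum_{j\in J}s_j(X_j-m_j)$, restricted to the cases where at least one of the bets in $J$ is not called off, has minimum $\le 0$ and maximum $\ge 0$. A bet on a conditional event is called off when it is void; a bet on the iterated conditional is called off in the cases where one receives back the paid amount $\mu$ whatever $\mu$ is (taking into account the relation $z=x\mu$ required by linearity of coherent previsions). *)

theory Defs
  imports Complex_Main "HOL-Library.Indicator_Function"
begin

text \<open>Events are sets of possible worlds; the impossible event is the empty set.\<close>

definition logically_independent :: "'w set \<Rightarrow> 'w set \<Rightarrow> 'w set \<Rightarrow> 'w set \<Rightarrow> bool" where
  "logically_independent A B H K \<longleftrightarrow>
     (\<forall>A' \<in> {A, - A}. \<forall>B' \<in> {B, - B}. \<forall>H' \<in> {H, - H}. \<forall>K' \<in> {K, - K}.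
        A' \<inter> B' \<inter> H' \<inter> K' \<noteq> {})"

text \<open>\<open>Cond E H\<close> is the conditional event \<open>E|H\<close>; \<open>H\<close> is understood to be nonempty.\<close>

datatype 'w cond_event = Cond (consequent: "'w set") (antecedent: "'w set")

fun conj_K :: "'w cond_event \<Rightarrow> 'w cond_event \<Rightarrow> 'w cond_event" (infixl \<open>\<and>\<^sub>K\<close> 70) where
  "Cond A H \<and>\<^sub>K Cond B K =
     Cond (A \<inter> H \<inter> B \<inter> K) ((H \<inter> K) \<union> (- A \<inter> H) \<union> (- B \<inter> K))"

text \<open>Numerical value of a conditional event whose probability is assessed as \<open>p\<close>.\<close>

definition cond_value :: "'w cond_event \<Rightarrow> real \<Rightarrow> 'w \<Rightarrow> real" where
  "cond_value e p \<omega> =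
     indicator (consequent e \<inter> antecedent e) \<omega> + p * indicator (- antecedent e) \<omega>"

text \<open>
  Value of the iterated conditional \<open>b |\<^sub>K a\<close>, where \<open>x\<close>, \<open>z\<close> and \<open>\<mu>\<close> are the assessed
  previsions of \<open>a\<close>, of \<open>a \<and>\<^sub>K b\<close> and of the iterated conditional itself. The factor of \<open>\<mu>\<close> is
  the negation of \<open>a\<close>, which is numerically \<open>1 - a\<close>.
\<close>

definition iter_value ::
    "'w cond_event \<Rightarrow> 'w cond_event \<Rightarrow> real \<Rightarrow> real \<Rightarrow> real \<Rightarrow> 'w \<Rightarrow> real" where
  "iter_value b a x z \<mu> \<omega> = cond_value (a \<and>\<^sub>K b) z \<omega> + \<mu> * (1 - cond_value a x \<omega>)"

text \<open>
  The objects on which bets are made: conditional events and iterated conditionals. An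
  assessment is a real function \<open>m\<close> on these objects. The value of \<open>Iter b a\<close> involves the
  assessed previsions of \<open>a\<close> and \<open>a \<and>\<^sub>K b\<close>, so a family that contains \<open>Iter b a\<close> is meant to
  contain these two conditional events as well.
\<close>

datatype 'w quantity =
    Event "'w cond_event"
  | Iter "'w cond_event" "'w cond_event"  (infix \<open>|\<^sub>K\<close> 65)

fun quantity_value :: "('w quantity \<Rightarrow> real) \<Rightarrow> 'w quantity \<Rightarrow> 'w \<Rightarrow> real" where
  "quantity_value m (Event e) \<omega> = cond_value e (m (Event e)) \<omega>"
| "quantity_value m (b |\<^sub>K a) \<omega> =
     iter_value b a (m (Event a)) (m (Event (a \<and>\<^sub>K b))) (m (b |\<^sub>K a)) \<omega>"

text \<open>
  A bet on an iterated conditional is called off where, for the assessed \<open>x\<close>, the paid amount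
  \<open>\<nu>\<close> is received back for every \<open>\<nu>\<close>, with \<open>z\<close> equal to \<open>x * \<nu>\<close> as linearity of previsions
  demands. The quantifier over \<open>\<nu>\<close> excludes accidental agreement of the value with the
  particular prevision in \<open>m\<close>; the set of worlds obtained still depends on \<open>x\<close> (it is larger
  for \<open>x = 0\<close> and for \<open>x = 1\<close>).
\<close>

fun called_off :: "('w quantity \<Rightarrow> real) \<Rightarrow> 'w quantity \<Rightarrow> 'w \<Rightarrow> bool" where
  "called_off m (Event e) \<omega> \<longleftrightarrow> \<omega> \<notin> antecedent e"
| "called_off m (b |\<^sub>K a) \<omega> \<longleftrightarrow>
     (\<forall>\<nu>. iter_value b a (m (Event a)) (m (Event a) * \<nu>) \<nu> \<omega> = \<nu>)"

definition gain ::
    "('w quantity \<Rightarrow> real) \<Rightarrow> 'w quantity set \<Rightarrow> ('w quantity \<Rightarrow> real) \<Rightarrow> 'w \<Rightarrow> real" where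
  "gain m J s \<omega> = (\<Sum>X\<in>J. s X * (quantity_value m X \<omega> - m X))"

text \<open>
  Every quantity takes finitely many values, hence so does the gain of a finite family of bets,
  and the minimum and maximum below range over a finite set even if there are infinitely many
  worlds.
\<close>

definition coherent :: "'w quantity set \<Rightarrow> ('w quantity \<Rightarrow> real) \<Rightarrow> bool" where
  "coherent F m \<longleftrightarrow>
     (\<forall>J s. finite J \<and> J \<subseteq> F \<and> J \<noteq> {} \<longrightarrow>
        (let G = gain m J s ` {\<omega>. \<exists>X\<in>J. \<not> called_off m X \<omega>}
         in Min G \<le> 0 \<and> Max G \<ge> 0))"

end

theory Submission
  imports Defs
begin

text \<open>
  Coherence means that no finite combination of bets wins (or, after changing the sign of the
  stakes, loses) in every world where at least one of its bets is on. The theorem rests on two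
  observations.

  First, the net value of a bet on \<open>b |\<^sub>K a\<close> is an affine combination of the net
  values of bets on \<open>a\<close> and \<open>a \<and>\<^sub>K b\<close>: it is \<open>(c - z) - \<mu> * (a - x) + (z - x * \<mu>)\<close>,
  where \<open>c\<close> is the value of the conjunction. A suitable combination of three bets therefore has
  the constant gain \<open>z - x * \<mu>\<close>, so coherence forces \<open>z = x * \<mu>\<close>. Simpler combinations show
  that probabilities lie in \<open>[0, 1]\<close> and that \<open>z \<le> min x y\<close>. If \<open>x = 0\<close> this
  leaves \<open>\<mu>\<close> undetermined, but a bet on the iterated conditional alone is then on
  exactly where \<open>a\<close> is true, its value there is \<open>0\<close> or \<open>1\<close>, and so \<open>\<mu> \<in> [0, 1]\<close>.

  Conversely, a set of bets \<open>J\<close> admits no sure gain as soon as finitely many worlds carry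
  nonnegative weights for which every bet in \<open>J\<close> is fair, with positive weight where some
  bet is on (\<open>no_sure_gain_if_fair\<close>). For given \<open>(x, y, z, \<mu>)\<close> the weights can depend on \<open>J\<close>,
  and they must: a joint distribution of the two conditional events in which neither is ever void
  satisfies \<open>z \<ge> x + y - 1\<close>, the lower Frechet--Hoeffding bound, which fails for the
  coherent assessments with small \<open>z\<close>. These are reached because weight can be put on worlds where
  one conditional event is true and the other is void: they reward the bets on \<open>a\<close>
  or \<open>b\<close> and call off the one on the conjunction.
\<close>

section \<open>Coherence as absence of a sure gain\<close>

lemma finite_range_combine:
  assumes "finite (range f)" and "finite (range g)"
  shows "finite (range (\<lambda>\<omega>. h (f \<omega>) (g \<omega>)))"
proof (rule finite_subset)
  show "range (\<lambda>\<omega>. h (f \<omega>) (g \<omega>)) \<subseteq> (\<lambda>(u, v). h u v) ` (range f \<times> range g)"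
    by auto
  show "finite ((\<lambda>(u, v). h u v) ` (range f \<times> range g))"
    using assms by simp
qed

lemma finite_range_cond_value: "finite (range (cond_value e p))"
proof (rule finite_subset)
  show "range (cond_value e p) \<subseteq> {0, 1, p}"
    by (auto simp: cond_value_def indicator_def)
qed simp

lemma finite_range_quantity_value: "finite (range (quantity_value m X))"
proof (cases X)
  case (Event e)
  then have "quantity_value m X = cond_value e (m (Event e))"
    by (simp add: fun_eq_iff)
  then show ?thesis
    by (simp add: finite_range_cond_value)
next
  case (Iter b a)
  then have "quantity_value m X = (\<lambda>\<omega>. cond_value (a \<and>\<^sub>K b) (m (Event (a \<and>\<^sub>K b))) \<omega>
      + m (b |\<^sub>K a) * (1 - cond_value a (m (Event a)) \<omega>))"
    by (simp add: fun_eq_iff iter_value_def)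
  then show ?thesis
    using finite_range_combine[where h = "\<lambda>u v. u + m (b |\<^sub>K a) * (1 - v)",
        OF finite_range_cond_value finite_range_cond_value]
    by simp
qed

lemma finite_range_gain: "finite (range (gain m J s))"
proof (induction J rule: infinite_finite_induct)
  case (insert X J)
  have "gain m (insert X J) s
      = (\<lambda>\<omega>. s X * (quantity_value m X \<omega> - m X) + gain m J s \<omega>)"
    using insert.hyps by (simp add: gain_def fun_eq_iff)
  then show ?case
    using finite_range_combine[where h = "\<lambda>u v. s X * (u - m X) + v",
        OF finite_range_quantity_value insert.IH]
    by simp
qed (simp_all add: gain_def)

lemma gain_uminus: "gain m J (\<lambda>X. - s X) \<omega> = - gain m J s \<omega>"
  by (simp add: gain_def sum_negf)

definition active :: "('w quantity \<Rightarrow> real) \<Rightarrow> 'w quantity set \<Rightarrow> 'w set" where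
  "active m J = {\<omega>. \<exists>X\<in>J. \<not> called_off m X \<omega>}"

text \<open>
  Nonempty sets of active worlds are essential in the next two lemmas, as the minimum of an empty
  set is unspecified. Replacing the stakes by their negatives turns a statement about the minimum
  into one about the maximum, so a single inequality suffices.
\<close>

lemma coherent_no_sure_gain:
  assumes "coherent F m" and "finite J" and "J \<subseteq> F" and "active m J \<noteq> {}"
  obtains \<omega> where "\<omega> \<in> active m J" and "gain m J s \<omega> \<le> 0"
proof -
  let ?G = "gain m J s ` active m J"
  have "J \<noteq> {}"
    using assms(4) by (auto simp: active_def)
  then have "Min ?G \<le> 0"
    using assms(1-3) by (auto simp: coherent_def active_def Let_def)
  moreover have "finite ?G"
    by (rule finite_subset[OF _ finite_range_gain]) auto
  then have "Min ?G \<in> ?G"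
    using assms(4) by (intro Min_in) auto
  ultimately show thesis
    using that by auto
qed

lemma coherentI:
  assumes "\<And>J s. finite J \<Longrightarrow> J \<subseteq> F \<Longrightarrow> J \<noteq> {} \<Longrightarrow> \<exists>\<omega>\<in>active m J. gain m J s \<omega> \<le> 0"
  shows "coherent F m"
  unfolding coherent_def Let_def active_def[symmetric]
proof (intro allI impI, elim conjE)
  fix J s
  assume J: "finite J" "J \<subseteq> F" "J \<noteq> {}"
  let ?G = "gain m J s ` active m J"
  have fin: "finite ?G"
    by (rule finite_subset[OF _ finite_range_gain]) auto
  obtain \<omega> where \<omega>: "\<omega> \<in> active m J" "gain m J s \<omega> \<le> 0"
    using assms J by blast
  obtain \<omega>' where \<omega>': "\<omega>' \<in> active m J" "gain m J (\<lambda>X. - s X) \<omega>' \<le> 0"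
    using assms J by blast
  have "Min ?G \<le> gain m J s \<omega>" "gain m J s \<omega>' \<le> Max ?G"
    using fin \<omega>(1) \<omega>'(1) by simp_all
  then show "Min ?G \<le> 0 \<and> 0 \<le> Max ?G"
    using \<omega>(2) \<omega>'(2) by (simp add: gain_uminus)
qed

text \<open>
  The easy direction of the theorem of the alternative: the weighted sum of the gains vanishes,
  whereas a sure gain would make it positive. Worlds where all bets are called off contribute
  nothing to the sum, whatever their weight; this lets one list of weights serve many
  sets \<open>J\<close>. A list of weighted worlds, unlike a weight function, does not need its worlds to be
  distinct.
\<close>

lemma no_sure_gain_if_fair:
  fixes ps :: "(real \<times> 'w) list"
  assumes called_off: "\<And>X \<omega>. X \<in> J \<Longrightarrow> called_off m X \<omega> \<Longrightarrow> quantity_value m X \<omega> = m X"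
    and nonneg: "\<And>p \<omega>. (p, \<omega>) \<in> set ps \<Longrightarrow> 0 \<le> p"
    and fair: "\<And>X. X \<in> J \<Longrightarrow> (\<Sum>(p, \<omega>)\<leftarrow>ps. p * (quantity_value m X \<omega> - m X)) = 0"
    and "Y \<in> J" and mass: "0 < (\<Sum>(p, \<omega>)\<leftarrow>ps. p * of_bool (\<not> called_off m Y \<omega>))"
  shows "\<exists>\<omega>\<in>active m J. gain m J s \<omega> \<le> 0"
proof (rule ccontr)
  assume "\<not> ?thesis"
  then have gain_pos: "0 < gain m J s \<omega>" if "\<omega> \<in> active m J" for \<omega>
    using that by force
  have gain_zero: "gain m J s \<omega> = 0" if "\<omega> \<notin> active m J" for \<omega>
    using that called_off by (auto simp: gain_def active_def intro!: sum.neutral)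
  have gain_nonneg: "0 \<le> gain m J s \<omega>" for \<omega>
    using gain_pos[of \<omega>] gain_zero[of \<omega>] by fastforce
  have "(\<Sum>(p, \<omega>)\<leftarrow>ps. p * gain m J s \<omega>)
      = (\<Sum>X\<in>J. s X * (\<Sum>(p, \<omega>)\<leftarrow>ps. p * (quantity_value m X \<omega> - m X)))"
    by (induction ps)
      (auto simp: gain_def sum.distrib sum_distrib_left algebra_simps split: prod.splits)
  also have "\<dots> = 0"
    using fair by simp
  finally have "(\<Sum>(p, \<omega>)\<leftarrow>ps. p * gain m J s \<omega>) = 0" .
  moreover have "\<forall>v \<in> set (map (\<lambda>(p, \<omega>). p * gain m J s \<omega>) ps). 0 \<le> v"
    using nonneg gain_nonneg by auto
  ultimately have "\<forall>v \<in> set (map (\<lambda>(p, \<omega>). p * gain m J s \<omega>) ps). v = 0"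
    using sum_list_nonneg_eq_0_iff by blast
  then have "p * of_bool (\<not> called_off m Y \<omega>) = 0" if "(p, \<omega>) \<in> set ps" for p \<omega>
    using that gain_pos[of \<omega>] \<open>Y \<in> J\<close> by (fastforce simp: active_def)
  then have "map (\<lambda>(p, \<omega>). p * of_bool (\<not> called_off m Y \<omega>)) ps = map (\<lambda>_. 0) ps"
    by auto
  then have "(\<Sum>(p, \<omega>)\<leftarrow>ps. p * of_bool (\<not> called_off m Y \<omega>)) = 0"
    by (simp only: sum_list_0)
  then show False
    using mass by simp
qed

section \<open>Necessary conditions\<close>

lemma coherent_event_unit_interval:
  assumes "coherent F m" and "Event e \<in> F" and "antecedent e \<noteq> {}"
  shows "m (Event e) \<in> {0..1}"
proof -
  have act: "active m {Event e} = antecedent e"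
    by (auto simp: active_def)
  obtain \<omega> where "\<omega> \<in> antecedent e" "gain m {Event e} (\<lambda>_. 1) \<omega> \<le> 0"
    using coherent_no_sure_gain[OF assms(1), of "{Event e}" "\<lambda>_. 1"] assms act by auto
  moreover obtain \<omega>' where "\<omega>' \<in> antecedent e" "gain m {Event e} (\<lambda>_. -1) \<omega>' \<le> 0"
    using coherent_no_sure_gain[OF assms(1), of "{Event e}" "\<lambda>_. -1"] assms act by auto
  ultimately show ?thesis
    by (auto simp: gain_def cond_value_def indicator_def of_bool_def split: if_splits)
qed

lemma conj_K_commute: "a \<and>\<^sub>K b = b \<and>\<^sub>K a"
  by (cases a; cases b) auto

text \<open>
  If the conjunction were assessed above \<open>a\<close>, then buying \<open>a\<close> and selling the conjunction would be a
  sure gain: where both bets are on, the value of the conjunction does not exceed that of \<open>a\<close>; where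
  only one is on, either \<open>a\<close> is true or the conjunction is false, and that bet wins
  because \<open>0 \<le> x < z \<le> 1\<close>.
\<close>

lemma coherent_conj_K_le:
  assumes coh: "coherent F m" and a: "Event a \<in> F" and c: "Event (a \<and>\<^sub>K b) \<in> F"
    and "a \<noteq> a \<and>\<^sub>K b" and ne: "antecedent a \<noteq> {}" "antecedent (a \<and>\<^sub>K b) \<noteq> {}"
  shows "m (Event (a \<and>\<^sub>K b)) \<le> m (Event a)"
proof (rule ccontr)
  obtain A H B K where ab: "a = Cond A H" "b = Cond B K"
    by (cases a; cases b)
  let ?x = "m (Event a)" and ?z = "m (Event (a \<and>\<^sub>K b))"
  let ?J = "{Event a, Event (a \<and>\<^sub>K b)}"
  let ?s = "\<lambda>X. if X = Event a then 1 else - 1 :: real"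
  assume "\<not> ?z \<le> ?x"
  then have less: "?x < ?z"
    by simp
  have unit: "?x \<in> {0..1}" "?z \<in> {0..1}"
    using coherent_event_unit_interval coh a c ne by blast+
  have "active m ?J \<noteq> {}"
    using ne by (auto simp: active_def)
  then obtain \<omega> where \<omega>: "\<omega> \<in> active m ?J" "gain m ?J ?s \<omega> \<le> 0"
    using coherent_no_sure_gain[OF coh, of ?J ?s] a c by auto
  have "gain m ?J ?s \<omega> = (cond_value a ?x \<omega> - ?x) - (cond_value (a \<and>\<^sub>K b) ?z \<omega> - ?z)"
    using \<open>a \<noteq> a \<and>\<^sub>K b\<close> by (auto simp: gain_def)
  then show False
    using \<omega> unit less
    by (auto simp: ab active_def cond_value_def indicator_def of_bool_def split: if_splits)
qed

text \<open>
  This identity makes a bet on the iterated conditional redundant, up to a constant, given bets on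
  the two conditional events from which it is built.
\<close>

lemma iter_value_net:
  "iter_value b a x z \<mu> \<omega> - \<mu>
    = (cond_value (a \<and>\<^sub>K b) z \<omega> - z) - \<mu> * (cond_value a x \<omega> - x) + (z - x * \<mu>)"
  by (simp add: iter_value_def algebra_simps)

text \<open>
  Stakes \<open>\<mu>\<close>, \<open>-1\<close> and \<open>1\<close> cancel everything in the identity above but the constant.
\<close>

lemma coherent_product_rule:
  assumes coh: "coherent F m"
    and F: "Event a \<in> F" "Event (a \<and>\<^sub>K b) \<in> F" "b |\<^sub>K a \<in> F"
    and "a \<noteq> a \<and>\<^sub>K b" and ne: "antecedent a \<noteq> {}"
  shows "m (Event (a \<and>\<^sub>K b)) = m (Event a) * m (b |\<^sub>K a)"
proof -
  let ?x = "m (Event a)" and ?z = "m (Event (a \<and>\<^sub>K b))" and ?\<mu> = "m (b |\<^sub>K a)"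
  let ?J = "{Event a, Event (a \<and>\<^sub>K b), b |\<^sub>K a}"
  let ?s = "\<lambda>X. if X = Event a then ?\<mu> else if X = Event (a \<and>\<^sub>K b) then - 1 else 1"
  have g: "gain m ?J ?s \<omega> = ?z - ?x * ?\<mu>" for \<omega>
    using \<open>a \<noteq> a \<and>\<^sub>K b\<close> by (auto simp: gain_def iter_value_net)
  have act: "active m ?J \<noteq> {}"
    using ne by (auto simp: active_def)
  have "?z - ?x * ?\<mu> \<le> 0"
    using coherent_no_sure_gain[OF coh _ _ act, of ?s] F g by auto
  moreover have "- (?z - ?x * ?\<mu>) \<le> 0"
    using coherent_no_sure_gain[OF coh _ _ act, of "\<lambda>X. - ?s X"] F g gain_uminus[of m ?J ?s]
    by auto
  ultimately show ?thesis
    by simp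
qed

text \<open>
  Being called off is insensitive to the particular \<open>\<mu>\<close>. For \<open>x = z = 0\<close> it happens wherever \<open>a\<close> is
  not true, so in the active worlds the iterated conditional is the value of the conjunction
  for \<open>z = 0\<close>, which is \<open>0\<close> or \<open>1\<close>.
\<close>

lemma coherent_iter_unit_interval:
  assumes coh: "coherent F m" and F: "b |\<^sub>K a \<in> F"
    and zero: "m (Event a) = 0" "m (Event (a \<and>\<^sub>K b)) = 0"
    and ne: "consequent a \<inter> antecedent a \<noteq> {}"
  shows "m (b |\<^sub>K a) \<in> {0..1}"
proof -
  obtain A H B K where ab: "a = Cond A H" "b = Cond B K"
    by (cases a; cases b)
  let ?J = "{b |\<^sub>K a}"
  have on: "quantity_value m (b |\<^sub>K a) \<omega> \<in> {0, 1}" if "\<omega> \<in> active m ?J" for \<omega>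
    using that zero
    by (auto simp: ab active_def iter_value_def cond_value_def indicator_def split: if_splits)
  obtain \<omega>\<^sub>0 where "\<omega>\<^sub>0 \<in> A" "\<omega>\<^sub>0 \<in> H"
    using ne ab by auto
  \<comment> \<open>where \<open>a\<close> is true, the value is the same for all \<open>\<nu>\<close>, so that it differs from some \<open>\<nu>\<close>\<close>
  then have "iter_value b a 0 0 2 \<omega>\<^sub>0 \<noteq> 2"
    by (auto simp: ab iter_value_def cond_value_def indicator_def)
  then have "\<not> (\<forall>\<nu>. iter_value b a 0 (0 * \<nu>) \<nu> \<omega>\<^sub>0 = \<nu>)"
    by (metis mult_zero_left)
  then have act: "active m ?J \<noteq> {}"
    using zero by (auto simp: active_def)
  obtain \<omega> where "\<omega> \<in> active m ?J" "gain m ?J (\<lambda>_. 1) \<omega> \<le> 0"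
    using coherent_no_sure_gain[OF coh _ _ act, of "\<lambda>_. 1"] F by auto
  moreover obtain \<omega>' where "\<omega>' \<in> active m ?J" "gain m ?J (\<lambda>_. - 1) \<omega>' \<le> 0"
    using coherent_no_sure_gain[OF coh _ _ act, of "\<lambda>_. - 1"] F by auto
  ultimately show ?thesis
    using on[of \<omega>] on[of \<omega>'] by (auto simp: gain_def simp del: quantity_value.simps)
qed

section \<open>Consequences of logical independence\<close>

lemma logically_independent_worlds:
  assumes "logically_independent A B H K"
  obtains \<omega> where "\<omega> \<in> A \<longleftrightarrow> p" and "\<omega> \<in> B \<longleftrightarrow> q" and "\<omega> \<in> H \<longleftrightarrow> r" and "\<omega> \<in> K \<longleftrightarrow> t"
proof -
  let ?A = "if p then A else - A" and ?B = "if q then B else - B"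
    and ?H = "if r then H else - H" and ?K = "if t then K else - K"
  have "?A \<inter> ?B \<inter> ?H \<inter> ?K \<noteq> {}"
    using assms unfolding logically_independent_def by simp
  then obtain \<omega> where "\<omega> \<in> ?A \<inter> ?B \<inter> ?H \<inter> ?K"
    by blast
  then show thesis
    by (intro that[of \<omega>]) (auto split: if_splits)
qed

text \<open>
  The assessments in the theorem are functions on the set of objects, so its right-hand side
  presupposes that the objects are different.
\<close>

lemma logically_independent_distinct:
  assumes "logically_independent A B H K"
  shows "Cond A H \<noteq> Cond B K"
    and "Cond A H \<noteq> Cond A H \<and>\<^sub>K Cond B K"
    and "Cond B K \<noteq> Cond A H \<and>\<^sub>K Cond B K"
proof -
  obtain \<omega> where "\<omega> \<in> A" "\<omega> \<notin> B"
    using logically_independent_worlds[OF assms, of True False True True] by metis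
  then show "Cond A H \<noteq> Cond B K"
    by auto
  \<comment> \<open>one conditional event is void and the other false, which makes the conjunction false\<close>
  obtain \<omega> where "\<omega> \<notin> B" "\<omega> \<notin> H" "\<omega> \<in> K"
    using logically_independent_worlds[OF assms, of False False False True] by metis
  then show "Cond A H \<noteq> Cond A H \<and>\<^sub>K Cond B K"
    by auto
  obtain \<omega> where "\<omega> \<notin> A" "\<omega> \<in> H" "\<omega> \<notin> K"
    using logically_independent_worlds[OF assms, of False False True False] by metis
  then show "Cond B K \<noteq> Cond A H \<and>\<^sub>K Cond B K"
    by auto
qed

section \<open>Fair weights\<close>

text \<open>
  Three kinds of bet sets need different weights. A world is named by the values of the two conditional
  events there: true, false or void.

  \<^item> The iterated conditional alone: \<open>\<mu>\<close> and \<open>1 - \<mu>\<close> on true-true and true-false. For \<open>x = 0\<close>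
    every list of nonnegative weights that is fair for \<open>a\<close> misses the worlds where this bet is on.
  \<^item> Other bet sets without \<open>b\<close>: any distribution on worlds without void events in which
    \<open>a\<close> has probability \<open>x\<close> and the conjunction has probability \<open>z\<close>.
  \<^item> Bet sets with \<open>b\<close>: the joint distribution with marginals \<open>x\<close>, \<open>y\<close> and
    joint probability \<open>z\<close> if the lower Frechet--Hoeffding bound allows it. Otherwise, weights on
    true-void and void-true top up the probabilities of \<open>a\<close> and \<open>b\<close>
    without affecting the bet on the conjunction.
\<close>

lemma coherent_if_bounds:
  fixes A B H K :: "'w set"
  defines "a \<equiv> Cond A H" and "b \<equiv> Cond B K"
  assumes ind: "logically_independent A B H K"
    and x: "m (Event a) = x" and y: "m (Event b) = y"
    and z: "m (Event (a \<and>\<^sub>K b)) = z" and \<mu>: "m (b |\<^sub>K a) = \<mu>"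
    and prod: "z = x * \<mu>" and \<mu>_unit: "0 \<le> \<mu>" "\<mu> \<le> 1"
    and bounds: "0 \<le> z" "z \<le> x" "z \<le> y" "x \<le> 1" "y \<le> 1"
  shows "coherent {Event a, Event b, Event (a \<and>\<^sub>K b), b |\<^sub>K a} m"
proof (rule coherentI)
  fix J s
  assume J: "finite J" "J \<subseteq> {Event a, Event b, Event (a \<and>\<^sub>K b), b |\<^sub>K a}" "J \<noteq> {}"
  obtain tt where tt: "tt \<in> A" "tt \<in> B" "tt \<in> H" "tt \<in> K"
    using logically_independent_worlds[OF ind, of True True True True] by metis
  obtain tf where tf: "tf \<in> A" "tf \<notin> B" "tf \<in> H" "tf \<in> K"
    using logically_independent_worlds[OF ind, of True False True True] by metis
  obtain ft where ft: "ft \<notin> A" "ft \<in> B" "ft \<in> H" "ft \<in> K"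
    using logically_independent_worlds[OF ind, of False True True True] by metis
  obtain ff where ff: "ff \<notin> A" "ff \<notin> B" "ff \<in> H" "ff \<in> K"
    using logically_independent_worlds[OF ind, of False False True True] by metis
  obtain tv where tv: "tv \<in> A" "tv \<in> B" "tv \<in> H" "tv \<notin> K"
    using logically_independent_worlds[OF ind, of True True True False] by metis
  obtain vt where vt: "vt \<in> A" "vt \<in> B" "vt \<notin> H" "vt \<in> K"
    using logically_independent_worlds[OF ind, of True True False True] by metis
  note worlds = tt tf ft ff tv vt
  note eval_simps = a_def b_def cond_value_def iter_value_def

  have called_off: "quantity_value m X \<omega> = m X" if "X \<in> J" "called_off m X \<omega>" for X \<omega>
  proof (cases "X = b |\<^sub>K a")
    case True
    \<comment> \<open>the case \<open>\<nu> = \<mu>\<close> in the definition of being called off\<close>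
    then have "iter_value b a x (x * \<mu>) \<mu> \<omega> = \<mu>"
      using that(2) x by simp
    then show ?thesis
      using True x z \<mu> prod by simp
  next
    case False
    moreover have "X \<in> {Event a, Event b, Event (a \<and>\<^sub>K b), b |\<^sub>K a}"
      using that(1) J(2) by blast
    ultimately obtain e where "X = Event e"
      by blast
    then show ?thesis
      using that(2) by (simp add: cond_value_def)
  qed

  \<comment> \<open>fairness for the iterated conditional follows from fairness for \<open>a\<close> and the conjunction\<close>
  have iter_fair: "(\<Sum>(p, \<omega>)\<leftarrow>ps. p * (quantity_value m (b |\<^sub>K a) \<omega> - m (b |\<^sub>K a))) = 0"
    if "(\<Sum>(p, \<omega>)\<leftarrow>ps. p * (cond_value a x \<omega> - x)) = 0"
      and "(\<Sum>(p, \<omega>)\<leftarrow>ps. p * (cond_value (a \<and>\<^sub>K b) z \<omega> - z)) = 0" for ps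
  proof -
    have "(\<Sum>(p, \<omega>)\<leftarrow>ps. p * (quantity_value m (b |\<^sub>K a) \<omega> - m (b |\<^sub>K a)))
      = (\<Sum>(p, \<omega>)\<leftarrow>ps. p * (cond_value (a \<and>\<^sub>K b) z \<omega> - z))
        - \<mu> * (\<Sum>(p, \<omega>)\<leftarrow>ps. p * (cond_value a x \<omega> - x))"
      using prod x z \<mu> by (induction ps) (auto simp: iter_value_net algebra_simps)
    then show ?thesis
      using that by simp
  qed

  consider (iter) "J = {b |\<^sub>K a}"
    | (without_b) Y where "Event b \<notin> J" "Y \<in> J" "Y = Event a \<or> Y = Event (a \<and>\<^sub>K b)"
    | (frechet) "Event b \<in> J" "x + y - 1 \<le> z"
    | (below_frechet) "Event b \<in> J" "z < x + y - 1"
    using J(2,3) by force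
  then show "\<exists>\<omega>\<in>active m J. gain m J s \<omega> \<le> 0"
  proof cases
    case iter
    let ?ps = "[(\<mu>, tt), (1 - \<mu>, tf)]"
    \<comment> \<open>any \<open>\<nu>\<close> other than the values \<open>0\<close> and \<open>1\<close> is a witness\<close>
    have "iter_value b a x (x * 2) 2 tt \<noteq> 2" "iter_value b a x (x * 2) 2 tf \<noteq> 2"
      using worlds by (simp_all add: eval_simps)
    then have on: "\<not> called_off m (b |\<^sub>K a) tt" "\<not> called_off m (b |\<^sub>K a) tf"
      unfolding called_off.simps x by blast+
    show ?thesis
    proof (rule no_sure_gain_if_fair[where ps = ?ps and Y = "b |\<^sub>K a"])
      show "0 < (\<Sum>(p, \<omega>)\<leftarrow>?ps. p * of_bool (\<not> called_off m (b |\<^sub>K a) \<omega>))"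
        using on by (simp del: called_off.simps)
    next
      fix X assume "X \<in> J"
      then show "(\<Sum>(p, \<omega>)\<leftarrow>?ps. p * (quantity_value m X \<omega> - m X)) = 0"
        using iter worlds \<mu> by (simp add: eval_simps algebra_simps)
    qed (use called_off iter \<mu>_unit in auto)
  next
    case without_b
    let ?ps = "[(z, tt), (x - z, tf), (1 - x, ff)]"
    have a_fair: "(\<Sum>(p, \<omega>)\<leftarrow>?ps. p * (cond_value a x \<omega> - x)) = 0"
      using worlds by (simp add: eval_simps algebra_simps)
    have c_fair: "(\<Sum>(p, \<omega>)\<leftarrow>?ps. p * (cond_value (a \<and>\<^sub>K b) z \<omega> - z)) = 0"
      using worlds by (simp add: eval_simps algebra_simps)
    show ?thesis
    proof (rule no_sure_gain_if_fair[where ps = ?ps and Y = Y])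
      fix X assume "X \<in> J"
      then have "X \<in> {Event a, Event (a \<and>\<^sub>K b), b |\<^sub>K a}"
        using J(2) without_b(1) by auto
      then show "(\<Sum>(p, \<omega>)\<leftarrow>?ps. p * (quantity_value m X \<omega> - m X)) = 0"
        using a_fair c_fair iter_fair[OF a_fair c_fair] x z by auto
    next
      show "0 < (\<Sum>(p, \<omega>)\<leftarrow>?ps. p * of_bool (\<not> called_off m Y \<omega>))"
        using without_b(3) worlds by (auto simp: a_def b_def)
    qed (use called_off without_b bounds in auto)
  next
    case frechet
    let ?ps = "[(z, tt), (x - z, tf), (y - z, ft), (1 - x - y + z, ff)]"
    have a_fair: "(\<Sum>(p, \<omega>)\<leftarrow>?ps. p * (cond_value a x \<omega> - x)) = 0"
      using worlds by (simp add: eval_simps algebra_simps)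
    have b_fair: "(\<Sum>(p, \<omega>)\<leftarrow>?ps. p * (cond_value b y \<omega> - y)) = 0"
      using worlds by (simp add: eval_simps algebra_simps)
    have c_fair: "(\<Sum>(p, \<omega>)\<leftarrow>?ps. p * (cond_value (a \<and>\<^sub>K b) z \<omega> - z)) = 0"
      using worlds by (simp add: eval_simps algebra_simps)
    show ?thesis
    proof (rule no_sure_gain_if_fair[where ps = ?ps and Y = "Event b"])
      fix X assume "X \<in> J"
      then have "X \<in> {Event a, Event b, Event (a \<and>\<^sub>K b), b |\<^sub>K a}"
        using J(2) by auto
      then show "(\<Sum>(p, \<omega>)\<leftarrow>?ps. p * (quantity_value m X \<omega> - m X)) = 0"
        using a_fair b_fair c_fair iter_fair[OF a_fair c_fair] x y z by auto
    next
      show "0 < (\<Sum>(p, \<omega>)\<leftarrow>?ps. p * of_bool (\<not> called_off m (Event b) \<omega>))"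
        using worlds by (simp add: b_def)
    qed (use called_off frechet bounds in auto)
  next
    case below_frechet
    define t where "t = x + y - 1"
    have t: "z < t" "t \<le> 1"
      using below_frechet bounds by (simp_all add: t_def)
    \<comment> \<open>Each of \<open>a\<close> and \<open>b\<close> gets total weight \<open>1 - z\<close>, and they are never false
      together. So the conjunction is false with weight \<open>(1 - t) * (1 - z)\<close> and, by fairness, true with
      weight \<open>z * (1 - t)\<close>. What \<open>a\<close> and \<open>b\<close> then lack for being fair is, for both, the
      weight \<open>t * (1 - z) - z * (1 - t) = t - z\<close> of being true.\<close>
    let ?ps = "[(z * (1 - t), tt), ((1 - y) * (1 - z), tf), ((1 - x) * (1 - z), ft),
      (t - z, tv), (t - z, vt)]"
    have a_fair: "(\<Sum>(p, \<omega>)\<leftarrow>?ps. p * (cond_value a x \<omega> - x)) = 0"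
      using worlds by (simp add: eval_simps t_def algebra_simps)
    have b_fair: "(\<Sum>(p, \<omega>)\<leftarrow>?ps. p * (cond_value b y \<omega> - y)) = 0"
      using worlds by (simp add: eval_simps t_def algebra_simps)
    have c_fair: "(\<Sum>(p, \<omega>)\<leftarrow>?ps. p * (cond_value (a \<and>\<^sub>K b) z \<omega> - z)) = 0"
      using worlds by (simp add: eval_simps t_def algebra_simps)
    have nonneg: "0 \<le> z * (1 - t)" "0 \<le> (1 - y) * (1 - z)" "0 \<le> (1 - x) * (1 - z)"
      using t bounds by (auto intro!: mult_nonneg_nonneg)
    show ?thesis
    proof (rule no_sure_gain_if_fair[where ps = ?ps and Y = "Event b"])
      fix X assume "X \<in> J"
      then have "X \<in> {Event a, Event b, Event (a \<and>\<^sub>K b), b |\<^sub>K a}"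
        using J(2) by auto
      then show "(\<Sum>(p, \<omega>)\<leftarrow>?ps. p * (quantity_value m X \<omega> - m X)) = 0"
        using a_fair b_fair c_fair iter_fair[OF a_fair c_fair] x y z by auto
    next
      show "0 < (\<Sum>(p, \<omega>)\<leftarrow>?ps. p * of_bool (\<not> called_off m (Event b) \<omega>))"
        using worlds nonneg t by (simp add: b_def)
    qed (use called_off below_frechet nonneg t in auto)
  qed
qed

section \<open>The set of coherent assessments\<close>

theorem theorem11:
  fixes A B H K :: "'w set"
  assumes "logically_independent A B H K"
  shows
    "(let a = Cond A H; b = Cond B K;
          F = {Event a, Event b, Event (a \<and>\<^sub>K b), b |\<^sub>K a}
      in {(m (Event a), m (Event b), m (Event (a \<and>\<^sub>K b)), m (b |\<^sub>K a)) | m. coherent F m})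
     = {(x, y, z, \<mu>). x \<in> {0<..1} \<and> y \<in> {0..1} \<and> z \<in> {0..min x y} \<and> \<mu> = z / x}
       \<union> {(0, y, 0, \<mu>) | y \<mu>. (y, \<mu>) \<in> {0..1} \<times> {0..1}}"
proof -
  define a b where "a = Cond A H" and "b = Cond B K"
  let ?F = "{Event a, Event b, Event (a \<and>\<^sub>K b), b |\<^sub>K a}"
  let ?S = "{(m (Event a), m (Event b), m (Event (a \<and>\<^sub>K b)), m (b |\<^sub>K a)) | m. coherent ?F m}"
  let ?R = "{(x, y, z, \<mu>). x \<in> {0<..1} \<and> y \<in> {0..1} \<and> z \<in> {0..min x y} \<and> \<mu> = z / x}
       \<union> {(0, y, 0, \<mu>) | y \<mu>. (y, \<mu>) \<in> {0..1} \<times> {0..1 :: real}} :: (real \<times> real \<times> real \<times> real) set"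
  note distinct = logically_independent_distinct[OF assms, folded a_def b_def]
  obtain \<omega> where "\<omega> \<in> A" "\<omega> \<in> B" "\<omega> \<in> H" "\<omega> \<in> K"
    using logically_independent_worlds[OF assms, of True True True True] by metis
  then have ne: "antecedent a \<noteq> {}" "antecedent b \<noteq> {}" "antecedent (a \<and>\<^sub>K b) \<noteq> {}"
      "consequent a \<inter> antecedent a \<noteq> {}"
    by (auto simp: a_def b_def)
  have coherent_bounds: "(m (Event a), m (Event b), m (Event (a \<and>\<^sub>K b)), m (b |\<^sub>K a)) \<in> ?R"
    if coh: "coherent ?F m" for m
  proof -
    let ?x = "m (Event a)" and ?y = "m (Event b)"
      and ?z = "m (Event (a \<and>\<^sub>K b))" and ?\<mu> = "m (b |\<^sub>K a)"
    have unit: "?x \<in> {0..1}" "?y \<in> {0..1}" "?z \<in> {0..1}"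
      using ne by (simp_all add: coherent_event_unit_interval[OF coh] del: atLeastAtMost_iff)
    have "?z \<le> ?x"
      using coherent_conj_K_le[OF coh, of a b] distinct ne by simp
    moreover have "?z \<le> ?y"
      using coherent_conj_K_le[OF coh, of b a] distinct ne by (simp add: conj_K_commute[of b a])
    moreover have "?z = ?x * ?\<mu>"
      using coherent_product_rule[OF coh, of a b] distinct ne by simp
    moreover have "?\<mu> \<in> {0..1}" if "?x = 0"
      using coherent_iter_unit_interval[OF coh, of b a] that ne \<open>?z = ?x * ?\<mu>\<close> by simp
    ultimately show ?thesis
      using unit by (cases "?x = 0") auto
  qed
  have bounds_coherent: "(x, y, z, \<mu>) \<in> ?S"
    if R: "(x, y, z, \<mu>) \<in> ?R" for x y z \<mu>
  proof -
    define m where "m = (\<lambda>X. if X = Event a then x else if X = Event b then y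
      else if X = Event (a \<and>\<^sub>K b) then z else \<mu>)"
    have m: "m (Event a) = x" "m (Event b) = y" "m (Event (a \<and>\<^sub>K b)) = z" "m (b |\<^sub>K a) = \<mu>"
      using distinct by (simp_all add: m_def)
    have "z = x * \<mu>" "0 \<le> \<mu>" "\<mu> \<le> 1" "0 \<le> z" "z \<le> x" "z \<le> y" "x \<le> 1" "y \<le> 1"
      using R by auto
    then have "coherent ?F m"
      using coherent_if_bounds[OF assms, folded a_def b_def, OF m] by simp
    then show ?thesis
      by (intro CollectI exI[of _ m]) (simp add: m)
  qed
  have "?S = ?R"
  proof (intro subset_antisym subsetI)
    fix v assume "v \<in> ?S"
    then obtain m where v: "v = (m (Event a), m (Event b), m (Event (a \<and>\<^sub>K b)), m (b |\<^sub>K a))"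
        and "coherent ?F m"
      by (elim CollectE exE conjE)
    then show "v \<in> ?R"
      unfolding v by (intro coherent_bounds)
  next
    fix v assume R: "v \<in> ?R"
    obtain x y z \<mu> where v: "v = (x, y, z, \<mu>)"
      by (rule prod_cases4)
    show "v \<in> ?S"
      using R unfolding v by (rule bounds_coherent)
  qed
  then show ?thesis
    by (simp only: Let_def a_def b_def)
qed

end
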